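(* Let $n\ge2$, $\mathcal{X}=\{1,\ldots,n\}$, let $\pi$ be the discrete uniform distribution on $\mathcal{X}$ and let $P$ be a symmetric transition matrix on $\mathcal{X}$ ($P = P^T\in\mathcal{L}(\pi)$). For $j\in\{2,\ldots,n\}$ let $Q_{1,j}$ be the permutation matrix of the transposition exchanging $1$ and $j$. Let $(R_l)$ be the sequence of alternating projections with the $n-1$ matrices $Q_{1,2},\ldots,Q_{1,n}$ started at $R_0=P$, and let $R_\infty$ be its limit. Let $\Pi$ be the matrix with all entries $1/n$. Then $$ R_\infty = (nb) \Pi + (a-b) I, $$ i.e. all diagonal entries of $R_\infty$ equal $a$ and all off-diagonal entries equal $b$, where $a = a(Q_{1,2},\ldots,Q_{1,n},P)$, $b = b(Q_{1,2},\ldots,Q_{1,n},P) \in [0,1]$ satisfy $nb + a-b = 1$. In particular, $R_\infty = \Pi$ if and only if $\mathrm{Tr}(P) = 1$.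
   Context: $\mathcal{L}(\pi)$ is the set of $\pi$-reversible transition matrices; for uniform $\pi$ these are the symmetric ones. Relabel $(Q_0,\ldots,Q_{m-1}):=(Q_{1,2},\ldots,Q_{1,n})$ with $m=n-1$. The sequence of alternating projections is $R_0:=P$, $R_l:=\frac12\big(R_{l-1}+Q R_{l-1}^* Q\big)$ with $Q=Q_{(l-1)\bmod m}$, for $l\ge1$, where $^*$ is the $\ell^2(\pi)$-adjoint (the transpose, for uniform $\pi$). $R_\infty$ denotes its limit $\lim_{l\to\infty}R_l$; it coincides with the unique minimizer of the $\pi$-weighted KL divergence $N\mapsto\sum_x\pi(x)\sum_yP(x,y)\ln\frac{P(x,y)}{N(x,y)}$ over the set of transition matrices $N$ with $\pi N=\pi$ and $N^*=Q_{1,j}NQ_{1,j}$ for all $j\in\{2,\ldots,n\}$. *)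

theory Defs
  imports "HOL-Analysis.Analysis" "HOL-Combinatorics.Transposition"
begin

definition uniform_distr :: "'n::finite \<Rightarrow> real" where
  "uniform_distr x = 1 / real CARD('n)"

definition transition_matrix :: "real^'n^'n::finite \<Rightarrow> bool" where
  "transition_matrix N \<longleftrightarrow> (\<forall>x y. 0 \<le> N $ x $ y) \<and> (\<forall>x. (\<Sum>y\<in>UNIV. N $ x $ y) = 1)"

definition reversible :: "('n::finite \<Rightarrow> real) \<Rightarrow> (real^'n^'n) set" where
  "reversible \<pi> = {N. transition_matrix N \<and> (\<forall>x y. \<pi> x * N $ x $ y = \<pi> y * N $ y $ x)}"

definition inner_wt :: "('n::finite \<Rightarrow> real) \<Rightarrow> real^'n \<Rightarrow> real^'n \<Rightarrow> real" where
  "inner_wt \<pi> f g = (\<Sum>x\<in>UNIV. \<pi> x * f $ x * g $ x)"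

text \<open>The adjoint with respect to \<open>inner_wt \<pi>\<close>, for strictly positive \<open>\<pi>\<close>; see
  \<open>inner_wt_adjoint_wt\<close>.\<close>

definition adjoint_wt :: "('n::finite \<Rightarrow> real) \<Rightarrow> real^'n^'n \<Rightarrow> real^'n^'n" where
  "adjoint_wt \<pi> N = (\<chi> x y. \<pi> y * N $ y $ x / \<pi> x)"

definition perm_matrix :: "('n::finite \<Rightarrow> 'n) \<Rightarrow> real^'n^'n" where
  "perm_matrix p = (\<chi> x y. if y = p x then 1 else 0)"

primrec alternating_projections ::
  "('n::finite \<Rightarrow> real) \<Rightarrow> nat \<Rightarrow> (nat \<Rightarrow> real^'n^'n) \<Rightarrow> real^'n^'n \<Rightarrow> nat \<Rightarrow> real^'n^'n" where
  "alternating_projections \<pi> m Q P 0 = P"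
| "alternating_projections \<pi> m Q P (Suc l) =
     (1/2) *\<^sub>R (alternating_projections \<pi> m Q P l
       + Q (l mod m) ** adjoint_wt \<pi> (alternating_projections \<pi> m Q P l) ** Q (l mod m))"

definition average_matrix :: "real^'n^'n::finite" where
  "average_matrix = (\<chi> x y. 1 / real CARD('n))"

lemma inner_wt_adjoint_wt:
  fixes \<pi> :: "'n::finite \<Rightarrow> real" and N :: "real^'n^'n"
  assumes "\<And>x. \<pi> x > 0"
  shows "inner_wt \<pi> (N *v f) g = inner_wt \<pi> f (adjoint_wt \<pi> N *v g)"
proof -
  have nz: "\<pi> x \<noteq> 0" for x
    using assms[of x] by simp
  have "inner_wt \<pi> (N *v f) g = (\<Sum>x\<in>UNIV. \<Sum>y\<in>UNIV. \<pi> x * N $ x $ y * f $ y * g $ x)"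
    by (simp add: inner_wt_def matrix_vector_mult_def sum_distrib_left sum_distrib_right mult_ac)
  also have "\<dots> = (\<Sum>y\<in>UNIV. \<Sum>x\<in>UNIV. \<pi> x * N $ x $ y * f $ y * g $ x)"
    by (rule sum.swap)
  also have "\<dots> = inner_wt \<pi> f (adjoint_wt \<pi> N *v g)"
    by (simp add: inner_wt_def adjoint_wt_def matrix_vector_mult_def sum_distrib_left nz mult_ac)
  finally show ?thesis .
qed

lemma adjoint_wt_uniform_distr: "adjoint_wt uniform_distr N = transpose N"
  by (simp add: adjoint_wt_def uniform_distr_def transpose_def vec_eq_iff)

lemma reversible_uniform_distr:
  "reversible uniform_distr = {N. transition_matrix N \<and> transpose N = N}"
  by (auto simp: reversible_def uniform_distr_def transpose_def vec_eq_iff)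

end

theory Submission
  imports Defs
begin

text \<open>
  On symmetric matrices every step is \<open>u \<mapsto> (u + S u) / 2\<close> for the linear isometry \<open>S\<close> that
  permutes rows and columns by a transposition. The parallelogram law makes the norms decrease
  by the squared step length, so the steps tend to \<open>0\<close>, and therefore \<open>S u - u\<close> tends to
  \<open>0\<close> along the sequence for each of the transpositions. Any two diagonal entries, and any two
  off-diagonal entries, are joined by transpositions, so the differences inside these two classes
  vanish in the limit. Since the sum over each class is invariant, all entries converge to
  the class averages of \<open>P\<close>.
\<close>

section \<open>Averages of linear isometries in an inner product space\<close>

text \<open>Equal norms make \<open>u - v\<close> and \<open>u + v\<close> orthogonal, so this is
  Pythagoras for the decomposition of \<open>u\<close> into half the difference and half the
  sum.\<close>

lemma averaging_step_norm:
  fixes u v :: "'a::real_inner"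
  assumes "norm v = norm u"
  shows "(norm (u - (1/2) *\<^sub>R (u + v)))\<^sup>2 = (norm u)\<^sup>2 - (norm ((1/2) *\<^sub>R (u + v)))\<^sup>2"
proof -
  have "v \<bullet> v = u \<bullet> u"
    using assms by (simp add: norm_eq_sqrt_inner)
  then show ?thesis
    by (simp add: power2_norm_eq_inner inner_diff_left inner_diff_right inner_add_left
        inner_add_right inner_commute[of v u] field_simps)
qed

text \<open>Time \<open>l\<close> only controls the isometry applied at that time. Every other
  \<open>S i\<close> is applied less than \<open>m\<close> steps later, and over so few steps
  \<open>u\<close> moves by a vanishing amount. Convergence of \<open>u\<close> itself is not
  claimed.\<close>

lemma isometry_averages_asymptotically_fixed:
  fixes u :: "nat \<Rightarrow> 'a::real_inner" and S :: "nat \<Rightarrow> 'a \<Rightarrow> 'a"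
  assumes step: "\<And>l. u (Suc l) = (1/2) *\<^sub>R (u l + S (l mod m) (u l))"
    and lin: "\<And>i. i < m \<Longrightarrow> linear (S i)"
    and iso: "\<And>i v. i < m \<Longrightarrow> norm (S i v) = norm v"
    and i: "i < m"
  shows "(\<lambda>l. S i (u l) - u l) \<longlonglongrightarrow> 0"
proof -
  have modm: "l mod m < m" for l
    using i by simp
  have sq: "(norm (u l - u (Suc l)))\<^sup>2 = (norm (u l))\<^sup>2 - (norm (u (Suc l)))\<^sup>2" for l
    unfolding step by (rule averaging_step_norm) (simp add: iso modm)
  have "decseq (\<lambda>l. (norm (u l))\<^sup>2)"
  proof (rule decseq_SucI)
    show "(norm (u (Suc l)))\<^sup>2 \<le> (norm (u l))\<^sup>2" for l
      using sq[of l] zero_le_power2[of "norm (u l - u (Suc l))"] by linarith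
  qed
  then obtain c where c: "(\<lambda>l. (norm (u l))\<^sup>2) \<longlonglongrightarrow> c"
    by (rule decseq_convergent[where B = 0]) auto
  \<comment> \<open>The squared step lengths are consecutive differences of a convergent
    sequence.\<close>
  have "(\<lambda>l. (norm (u l - u (Suc l)))\<^sup>2) \<longlonglongrightarrow> 0"
    unfolding sq using tendsto_diff[OF c LIMSEQ_Suc[OF c]] by simp
  then have "(\<lambda>l. sqrt ((norm (u l - u (Suc l)))\<^sup>2)) \<longlonglongrightarrow> sqrt 0"
    by (rule tendsto_real_sqrt)
  then have steps: "(\<lambda>l. u l - u (Suc l)) \<longlonglongrightarrow> 0"
    by (simp add: tendsto_norm_zero_iff)
  have step0: "(\<lambda>l. u (Suc l) - u l) \<longlonglongrightarrow> 0"
    using tendsto_minus[OF steps] by simp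
  have shift0: "(\<lambda>l. u (l + k) - u l) \<longlonglongrightarrow> 0" for k
  proof (induction k)
    case (Suc k)
    show ?case
      using tendsto_add[OF LIMSEQ_ignore_initial_segment[OF step0, of k] Suc] by simp
  qed simp
  have S0: "(\<lambda>l. S (l mod m) (u l) - u l) \<longlonglongrightarrow> 0"
  proof -
    have "S (l mod m) (u l) - u l = 2 *\<^sub>R (u (Suc l) - u l)" for l
      unfolding step by (simp add: scaleR_diff_right scaleR_add_right scaleR_2)
    then show ?thesis
      using tendsto_scaleR[OF tendsto_const step0, of 2] by simp
  qed
  have S_shift0: "(\<lambda>l. norm (S ((l + s) mod m) (u l) - u l)) \<longlonglongrightarrow> 0" for s
  proof (rule tendsto_sandwich[OF _ _ tendsto_const])
    \<comment> \<open>The factor 2 arises because \<open>u (l + s)\<close> is replaced by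
      \<open>u l\<close> both inside and outside the isometry, at the same cost each time.\<close>
    let ?w = "\<lambda>l. S (l mod m) (u l) - u l"
    have "norm (S ((l + s) mod m) (u l) - u l) \<le> norm (?w (l + s)) + 2 * norm (u (l + s) - u l)"
      for l
    proof -
      let ?T = "S ((l + s) mod m)"
      have "norm (?T (u (l + s)) - ?T (u l)) = norm (u (l + s) - u l)"
        using linear_diff[OF lin[OF modm]] iso[OF modm] by metis
      moreover have "?T (u l) - u l = ?w (l + s) + (u (l + s) - u l) - (?T (u (l + s)) - ?T (u l))"
        by simp
      then have "norm (?T (u l) - u l)
          \<le> norm (?w (l + s) + (u (l + s) - u l)) + norm (?T (u (l + s)) - ?T (u l))"
        by (metis norm_triangle_ineq4)
      moreover have "norm (?w (l + s) + (u (l + s) - u l)) \<le> norm (?w (l + s)) + norm (u (l + s) - u l)"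
        by (rule norm_triangle_ineq)
      ultimately show ?thesis
        by linarith
    qed
    then show "\<forall>\<^sub>F l in sequentially. norm (S ((l + s) mod m) (u l) - u l)
        \<le> norm (?w (l + s)) + 2 * norm (u (l + s) - u l)"
      by simp
    show "(\<lambda>l. norm (?w (l + s)) + 2 * norm (u (l + s) - u l)) \<longlonglongrightarrow> 0"
      using tendsto_add[OF tendsto_norm[OF LIMSEQ_ignore_initial_segment[OF S0, of s]]
          tendsto_mult[OF tendsto_const tendsto_norm[OF shift0[of s]], of 2]]
      by simp
  qed simp
  have "(\<lambda>l. norm (S i (u l) - u l)) \<longlonglongrightarrow> 0"
  proof (rule tendsto_sandwich[OF _ _ tendsto_const])
    \<comment> \<open>The delay \<open>s\<close> until \<open>S i\<close> is next applied depends on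
      \<open>l\<close>; summing over all \<open>s < m\<close> gives a bound with a fixed finite set
      of delays.\<close>
    have "norm (S i (u l) - u l) \<le> (\<Sum>s<m. norm (S ((l + s) mod m) (u l) - u l))" for l
    proof -
      define s where "s = (i + (m - l mod m)) mod m"
      have "(l + s) mod m = (l mod m + (i + (m - l mod m))) mod m"
        by (simp add: s_def mod_simps)
      also have "l mod m + (i + (m - l mod m)) = i + m"
        using modm[of l] by linarith
      also have "(i + m) mod m = i"
        using i by simp
      finally have "(l + s) mod m = i" .
      moreover have "s \<in> {..<m}"
        using i by (simp add: s_def)
      ultimately show ?thesis
        using member_le_sum[of s "{..<m}" "\<lambda>s. norm (S ((l + s) mod m) (u l) - u l)"] by simp
    qed
    then show "\<forall>\<^sub>F l in sequentially. norm (S i (u l) - u l)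
        \<le> (\<Sum>s<m. norm (S ((l + s) mod m) (u l) - u l))"
      by simp
    show "(\<lambda>l. \<Sum>s<m. norm (S ((l + s) mod m) (u l) - u l)) \<longlonglongrightarrow> 0"
      by (rule tendsto_null_sum) (rule S_shift0)
  qed simp
  then show ?thesis
    by (rule tendsto_norm_zero_cancel)
qed

text \<open>The deviation of \<open>f l z\<close> from the constant average is the average of the
  differences \<open>f l z - f l w\<close>, all of which vanish in the limit.\<close>

lemma tendsto_average_of_asymptotically_equal:
  fixes f :: "nat \<Rightarrow> 'a \<Rightarrow> real"
  assumes "finite Z" "z \<in> Z"
    and diff: "\<And>w. w \<in> Z \<Longrightarrow> (\<lambda>l. f l z - f l w) \<longlonglongrightarrow> 0"
    and sum: "\<And>l. (\<Sum>w\<in>Z. f l w) = c"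
  shows "(\<lambda>l. f l z) \<longlonglongrightarrow> c / real (card Z)"
proof -
  have card: "card Z \<noteq> 0"
    using assms(1,2) by auto
  have "f l z = (c + (\<Sum>w\<in>Z. f l z - f l w)) / real (card Z)" for l
    using card by (simp add: sum_subtractf sum)
  moreover have "(\<lambda>l. (c + (\<Sum>w\<in>Z. f l z - f l w)) / real (card Z)) \<longlonglongrightarrow> (c + 0) / real (card Z)"
    by (intro tendsto_intros tendsto_null_sum diff) (use card in auto)
  ultimately show ?thesis
    by simp
qed

section \<open>Simultaneous permutation of rows and columns\<close>

definition permute_matrix :: "('n \<Rightarrow> 'n) \<Rightarrow> 'a^'n^'n \<Rightarrow> 'a^'n^'n::finite" where
  "permute_matrix p A = (\<chi> x y. A $ p x $ p y)"

lemma permute_matrix_nth [simp]: "permute_matrix p A $ x $ y = A $ p x $ p y"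
  by (simp add: permute_matrix_def)

lemma linear_permute_matrix: "linear (permute_matrix p :: real^'n^'n \<Rightarrow> real^'n^'n::finite)"
  by (rule linearI) (simp_all add: vec_eq_iff)

text \<open>The map \<open>map_prod p p\<close> permutes the invariant set \<open>Z\<close>. Squares
  over all index pairs give the norm; the identity over \<open>Id\<close> and \<open>- Id\<close>
  gives the two conserved sums.\<close>

lemma sum_permute_matrix:
  fixes g :: "'a \<Rightarrow> 'b::comm_monoid_add"
  assumes "bij p" "\<And>x y. (p x, p y) \<in> Z \<longleftrightarrow> (x, y) \<in> Z"
  shows "(\<Sum>(x, y)\<in>Z. g (permute_matrix p A $ x $ y)) = (\<Sum>(x, y)\<in>Z. g (A $ x $ y))"
proof (rule sum.reindex_bij_witness[of _ "map_prod (inv p) (inv p)" "map_prod p p"])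
  have p: "p (inv p x) = x" "inv p (p x) = x" for x
    using assms(1) by (simp_all add: bij_is_surj surj_f_inv_f bij_is_inj)
  show "map_prod (inv p) (inv p) z \<in> Z" if "z \<in> Z" for z
    using that assms(2) p by (metis map_prod_simp surj_pair)
qed (use assms in \<open>auto simp: bij_is_surj surj_f_inv_f bij_is_inj\<close>)

lemma norm_permute_matrix:
  fixes A :: "real^'n^'n::finite"
  assumes "bij p"
  shows "norm (permute_matrix p A) = norm A"
proof -
  have "B \<bullet> B = (\<Sum>(x, y)\<in>UNIV. (B $ x $ y)\<^sup>2)" for B :: "real^'n^'n"
    by (simp add: inner_vec_def sum.cartesian_product power2_eq_square)
  then show ?thesis
    using sum_permute_matrix[OF assms, of UNIV "\<lambda>t. t\<^sup>2" A] by (simp add: norm_eq_sqrt_inner)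
qed

text \<open>Right multiplication moves columns by the inverse of \<open>p\<close>, which is
  \<open>p\<close> itself for an involution.\<close>

lemma perm_matrix_conjugate:
  fixes A :: "real^'n^'n::finite"
  assumes "\<And>x. p (p x) = x"
  shows "perm_matrix p ** A ** perm_matrix p = permute_matrix p A"
proof -
  have left: "(perm_matrix p ** A) $ x $ y = A $ p x $ y" for x y
    by (simp add: matrix_matrix_mult_def perm_matrix_def if_distrib if_distribR cong: if_cong)
  have "y = p w \<longleftrightarrow> w = p y" for y w
    using assms by metis
  then have "(B ** perm_matrix p) $ x $ y = B $ x $ p y" for B :: "real^'n^'n" and x y
    by (simp add: matrix_matrix_mult_def perm_matrix_def if_distrib cong: if_cong)
  with left show ?thesis
    by (simp add: vec_eq_iff)
qed

theorem theorem5p1: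
  fixes n :: nat and e :: "nat \<Rightarrow> 'n::finite"
    and P :: "real^'n^'n" and Q R :: "nat \<Rightarrow> real^'n^'n"
  assumes "n \<ge> 2"
    and "bij_betw e {1..n} (UNIV :: 'n set)"
    and "P \<in> reversible uniform_distr" and "P = Finite_Cartesian_Product.transpose P"
    and "\<And>j. j \<in> {2..n} \<Longrightarrow> Q j = perm_matrix (Transposition.transpose (e 1) (e j))"
    and "R = alternating_projections uniform_distr (n - 1) (\<lambda>i. Q (i + 2)) P"
  shows "convergent R \<and>
    (\<exists>a\<in>{0..1}. \<exists>b\<in>{0..1}.
       lim R = (real n * b) *\<^sub>R average_matrix + (a - b) *\<^sub>R mat 1 \<and>
       (\<forall>x. lim R $ x $ x = a) \<and> (\<forall>x y. x \<noteq> y \<longrightarrow> lim R $ x $ y = b) \<and>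
       real n * b + a - b = 1) \<and>
    (lim R = average_matrix \<longleftrightarrow> trace P = 1)"
proof -
  note n2 = assms(1) and e = assms(2) and PR = assms(3) and PT = assms(4) and Qj = assms(5)
    and R = assms(6)

  \<comment> \<open>Reduction to averages of isometries\<close>
  define m where "m = n - 1"
  define p where "p i = Transposition.transpose (e 1) (e (i + 2))" for i
  have m: "l mod m < m" for l
    using n2 by (simp add: m_def)
  have Q: "Q (l mod m + 2) = perm_matrix (p (l mod m))" for l
    using Qj[of "l mod m + 2"] m[of l] by (simp add: p_def m_def)
  have pp: "p i (p i x) = x" and bij_p: "bij (p i)" for i x
    by (simp_all add: p_def)
  have p_eq: "p i x = p i y \<longleftrightarrow> x = y" for i x y
    using pp by metis
  have R0: "R 0 = P"
    by (simp add: R)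
  have R_Suc: "R (Suc l) = (1/2) *\<^sub>R (R l + permute_matrix (p (l mod m))
      (Finite_Cartesian_Product.transpose (R l)))" for l
    unfolding R alternating_projections.simps m_def[symmetric] adjoint_wt_uniform_distr Q
      perm_matrix_conjugate[OF pp] ..
  \<comment> \<open>Symmetry survives each step because rows and columns are permuted alike; the
    adjoint then drops out, leaving averages with the isometries
    \<open>permute_matrix (p i)\<close>.\<close>
  have sym: "Finite_Cartesian_Product.transpose (R l) = R l" for l
  proof (induction l)
    case 0
    show ?case
      using PT by (simp add: R0)
  next
    case (Suc l)
    then have "R l $ x $ y = R l $ y $ x" for x y
      by (simp add: vec_eq_iff Finite_Cartesian_Product.transpose_def)
    then show ?case
      by (simp add: R_Suc vec_eq_iff Finite_Cartesian_Product.transpose_def)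
  qed
  have sym': "R l $ x $ y = R l $ y $ x" for l x y
    using sym[of l] by (simp add: vec_eq_iff Finite_Cartesian_Product.transpose_def)
  have step: "R (Suc l) = (1/2) *\<^sub>R (R l + permute_matrix (p (l mod m)) (R l))" for l
    using R_Suc by (simp add: sym)
  have fixed: "(\<lambda>l. permute_matrix (p i) (R l) - R l) \<longlonglongrightarrow> 0" if "i < m" for i
    using isometry_averages_asymptotically_fixed[OF step linear_permute_matrix
        norm_permute_matrix[OF bij_p] that] .
  have card_n: "CARD('n) = n"
    using bij_betw_same_card[OF e] by simp

  \<comment> \<open>Asymptotic equality of entries\<close>
  define sim where "sim z w \<longleftrightarrow> (\<lambda>l. R l $ fst z $ snd z - R l $ fst w $ snd w) \<longlonglongrightarrow> 0" for z w
  have sim_refl: "sim z z" for z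
    by (simp add: sim_def)
  have sim_trans: "sim z v" if "sim z w" "sim w v" for z w v
    using tendsto_add[OF that[unfolded sim_def]] by (simp add: sim_def)
  have sim_sym: "sim w z" if "sim z w" for z w
    using tendsto_minus[OF that[unfolded sim_def]] by (simp add: sim_def)
  have sim_flip: "sim (x, y) (y, x)" for x y
    by (simp add: sim_def sym'[of _ x y])
  define c where "c = e 1"
  have sim_transpose:
    "sim (Transposition.transpose c k x, Transposition.transpose c k y) (x, y)" for k x y
  proof (cases "k = c")
    case True
    then show ?thesis
      by (simp add: sim_refl)
  next
    case False
    obtain j where j: "j \<in> {1..n}" "k = e j"
      using e unfolding bij_betw_def by blast
    then have "j \<noteq> 1"
      using False by (auto simp: c_def)
    with j(1) have "2 \<le> j" "j \<le> n"
      by auto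
    then have "j - 2 < m" "j - 2 + 2 = j"
      by (simp_all add: m_def)
    with fixed[of "j - 2"] j(2)
    have "(\<lambda>l. permute_matrix (Transposition.transpose c k) (R l) - R l) \<longlonglongrightarrow> 0"
      by (simp add: p_def c_def)
    then have "(\<lambda>l. (permute_matrix (Transposition.transpose c k) (R l) - R l) $ x $ y)
        \<longlonglongrightarrow> 0 $ x $ y"
      by (intro tendsto_vec_nth)
    then show ?thesis
      by (simp add: sim_def)
  qed
  have sim_diag: "sim (x, x) (y, y)" for x y
    using sim_transpose[of x c c] sim_transpose[of y c c] by (auto intro: sim_trans sim_sym)
  \<comment> \<open>For distinct \<open>y\<close> and \<open>k\<close> no single transposition
    suffices, since each one moves \<open>c\<close>. The path goes from \<open>(c, y)\<close> to
    \<open>(k, y)\<close>, by symmetry of the matrices to \<open>(y, k)\<close>, and on to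
    \<open>(c, k)\<close>.\<close>
  have sim_row: "sim (c, y) (c, k)" if "y \<noteq> c" "k \<noteq> c" for y k
  proof (cases "y = k")
    case True
    then show ?thesis
      by (simp add: sim_refl)
  next
    case False
    have "sim (c, y) (k, y)"
      using sim_transpose[of k k y] that False by simp
    moreover have "sim (c, k) (y, k)"
      using sim_transpose[of y y k] that False by simp
    ultimately show ?thesis
      using sim_trans[OF _ sim_trans[OF sim_flip sim_sym]] by blast
  qed
  have to_row: "\<exists>k. k \<noteq> c \<and> sim (x, y) (c, k)" if "x \<noteq> y" for x y
  proof -
    consider "x = c" | "y = c" | "x \<noteq> c" "y \<noteq> c"
      by blast
    then show ?thesis
    proof cases
      case 1
      then show ?thesis
        using that sim_refl[of "(x, y)"] by auto
    next
      case 2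
      then show ?thesis
        using that sim_flip[of x y] by auto
    next
      case 3
      then have "sim (c, y) (x, y)"
        using sim_transpose[of x x y] that by simp
      then show ?thesis
        using 3 sim_sym[of "(c, y)" "(x, y)"] by blast
    qed
  qed
  have sim_off: "sim (x, y) (x', y')" if neq: "x \<noteq> y" "x' \<noteq> y'"
    for x y x' y'
  proof -
    obtain k k' where "k \<noteq> c" "sim (x, y) (c, k)" "k' \<noteq> c" "sim (x', y') (c, k')"
      using to_row[OF neq(1)] to_row[OF neq(2)] by blast
    then show ?thesis
      using sim_trans[OF _ sim_trans[OF sim_row sim_sym]] by blast
  qed

  \<comment> \<open>Conserved diagonal and off-diagonal sums\<close>
  have sum_inv: "(\<Sum>(x, y)\<in>Z. R l $ x $ y) = (\<Sum>(x, y)\<in>Z. P $ x $ y)"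
    if Z: "\<And>i x y. (p i x, p i y) \<in> Z \<longleftrightarrow> (x, y) \<in> Z" for Z l
  proof (induction l)
    case (Suc l)
    have "(\<Sum>(x, y)\<in>Z. R (Suc l) $ x $ y) = ((\<Sum>(x, y)\<in>Z. R l $ x $ y)
        + (\<Sum>(x, y)\<in>Z. permute_matrix (p (l mod m)) (R l) $ x $ y)) / 2"
      by (simp add: step split_def sum.distrib sum_divide_distrib[symmetric])
    also have "\<dots> = (\<Sum>(x, y)\<in>Z. R l $ x $ y)"
      using sum_permute_matrix[OF bij_p, of "l mod m" Z "\<lambda>t. t" "R l"] Z by simp
    finally show ?case
      using Suc by simp
  qed (simp add: R0)

  have diag_sum: "(\<Sum>(x, y)\<in>Id. A $ x $ y) = trace A" for A :: "real^'n^'n"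
    unfolding trace_def
    by (rule sum.reindex_bij_witness[of _ "\<lambda>x. (x, x)" fst]) auto
  have trans_P: "transition_matrix P"
    using PR by (simp add: reversible_def)
  have P_nonneg: "0 \<le> P $ x $ y" and P_row: "(\<Sum>y\<in>UNIV. P $ x $ y) = 1" for x y
    using trans_P by (auto simp: transition_matrix_def)
  have P_le: "P $ x $ y \<le> 1" for x y
    using member_le_sum[of y UNIV "\<lambda>y. P $ x $ y"] P_nonneg P_row by simp
  have "(\<Sum>(x, y)\<in>UNIV. P $ x $ y) = real n"
    using P_row card_n by (simp add: sum.cartesian_product[symmetric] flip: UNIV_Times_UNIV)
  then have off_sum: "(\<Sum>(x, y)\<in>-Id. P $ x $ y) = real n - trace P"
    by (simp add: Compl_eq_Diff_UNIV sum_diff diag_sum)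
  have card_diag: "card (Id :: ('n \<times> 'n) set) = n"
  proof -
    have "(Id :: ('n \<times> 'n) set) = range (\<lambda>x. (x, x))"
      by auto
    also have "card \<dots> = n"
      by (subst card_image) (auto simp: inj_on_def card_n)
    finally show ?thesis .
  qed
  then have card_off: "card (- Id :: ('n \<times> 'n) set) = n * n - n"
    using card_n by (simp add: Compl_eq_Diff_UNIV card_Diff_subset)

  \<comment> \<open>The limit matrix\<close>
  define a where "a = trace P / real n"
  \<comment> \<open>All entries of \<open>P\<close> sum to \<open>n\<close>, so the off-diagonal
    ones sum to \<open>n - trace P\<close>; \<open>b\<close> is their mean over the
    \<open>n * n - n\<close> positions.\<close>
  define b where "b = (real n - trace P) / (real n * (real n - 1))"
  have lim_diag: "(\<lambda>l. R l $ x $ x) \<longlonglongrightarrow> a" for x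
    using tendsto_average_of_asymptotically_equal[of Id "(x, x)" "\<lambda>l (x, y). R l $ x $ y" "trace P"]
      sim_diag sum_inv[of Id] p_eq diag_sum card_diag
    by (auto simp: a_def sim_def)
  have lim_off: "(\<lambda>l. R l $ x $ y) \<longlonglongrightarrow> b" if "x \<noteq> y" for x y
    using tendsto_average_of_asymptotically_equal[of "-Id" "(x, y)" "\<lambda>l (x, y). R l $ x $ y"
        "real n - trace P"] that
      sim_off sum_inv[of "-Id"] p_eq off_sum card_off n2
    by (auto simp: b_def sim_def of_nat_diff algebra_simps)
  define L :: "real^'n^'n" where "L = (\<chi> x y. if x = y then a else b)"
  have "R \<longlonglongrightarrow> L"
  proof (intro vec_tendstoI)
    show "(\<lambda>l. R l $ x $ y) \<longlonglongrightarrow> L $ x $ y" for x y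
      using lim_diag lim_off by (cases "x = y") (simp_all add: L_def)
  qed
  then have conv: "convergent R" and lim: "lim R = L"
    by (auto simp: convergent_def limI)
  have tr: "0 \<le> trace P" "trace P \<le> real n"
    using P_nonneg P_le sum_bounded_above[of "UNIV :: 'n set" "\<lambda>x. P $ x $ x" 1] card_n
    by (auto simp: trace_def intro: sum_nonneg)
  then have a01: "a \<in> {0..1}"
    using n2 by (simp add: a_def field_simps)
  \<comment> \<open>This is the row sum \<open>a + (n - 1) * b\<close> of the limit.\<close>
  have ab: "real n * b + a - b = 1"
  proof -
    have "real n * b + a - b = (real n - 1) * b + a"
      by (simp add: algebra_simps)
    also have "\<dots> = 1"
      using n2 by (simp add: a_def b_def field_simps)
    finally show ?thesis .
  qed
  have "0 \<le> b"
    using tr n2 by (simp add: b_def)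
  \<comment> \<open>The row sum gives \<open>(n - 1) * b = 1 - a\<close>, which is at most 1; as
    \<open>n - 1\<close> is at least 1, this also bounds \<open>b\<close>.\<close>
  moreover have "b \<le> (real n - 1) * b"
    using n2 \<open>0 \<le> b\<close> mult_right_mono[of 1 "real n - 1" b] by simp
  ultimately have b01: "b \<in> {0..1}"
    using ab a01 by (auto simp: algebra_simps)
  have form: "L = (real n * b) *\<^sub>R average_matrix + (a - b) *\<^sub>R mat 1"
    using n2 by (auto simp: L_def vec_eq_iff average_matrix_def mat_def card_n)
  have "L = average_matrix \<longleftrightarrow> trace P = 1"
  proof
    assume "L = average_matrix"
    then have "L $ c $ c = average_matrix $ c $ c"
      by simp
    then show "trace P = 1"
      using n2 by (simp add: L_def average_matrix_def a_def card_n field_simps)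
  next
    assume "trace P = 1"
    then have "a = 1 / real n" "b = 1 / real n"
      using n2 by (simp_all add: a_def b_def field_simps)
    then show "L = average_matrix"
      by (simp add: L_def average_matrix_def vec_eq_iff card_n)
  qed
  moreover have "\<forall>x. L $ x $ x = a" "\<forall>x y. x \<noteq> y \<longrightarrow> L $ x $ y = b"
    by (simp_all add: L_def)
  ultimately show ?thesis
    unfolding lim
    by (intro conjI bexI[OF _ a01] bexI[OF _ b01] conv form ab)
qed

end
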